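(* There exists a small set $A\subseteq2^\omega\times2^\omega$ such that $(A\cap([S]\times[S]))\setminus\Delta\neq\emptyset$ for every Silver tree $S\subseteq2^{<\omega}$, where $\Delta=\{(x,x):x\in2^\omega\}$.
   Context: A set $A\subseteq2^\omega$ is small if there are a partition $\mathcal A$ of $\omega$ into finite sets and a collection $(J_a)_{a\in\mathcal A}$ with $J_a\subseteq2^a$ such that $\sum_{a\in\mathcal A}\frac{|J_a|}{2^{|a|}}<\infty$ and $A=\{x\in2^\omega: x\restriction a\in J_a\text{ for infinitely many }a\in\mathcal A\}$. A subset of $2^\omega\times2^\omega$ is small if it corresponds to a small subset of $2^\omega$ under the canonical homeomorphism $2^\omega\to2^\omega\times2^\omega$, $z\mapsto\big((z(2n))_{n\in\omega},(z(2n+1))_{n\in\omega}\big)$. A tree is a nonempty set $T\subseteq2^{<\omega}=\bigcup_n2^n$ closed under initial segments, with body $[T]=\{x\in2^\omega:(\forall n)\ x\restriction n\in T\}$. It is perfect if every $\sigma\in T$ has an extension $\tau\in T$ with $\tau^\frown0,\tau^\frown1\in T$. A Silver tree is a perfect tree $T$ such that for all $\sigma,\tau\in T$ with $|\sigma|=|\tau|$ and all $a\in\{0,1\}$: $\sigma^\frown a\in T\iff\tau^\frown a\in T$. *)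

theory Defs
  imports "HOL-Analysis.Infinite_Sum" "HOL-Library.Disjoint_Sets" "HOL-Library.FuncSet"
    "HOL-Library.Sublist"
begin

text \<open>The digits 0 and 1 are rendered as \<^term>\<open>False\<close> and \<^term>\<open>True\<close>.\<close>

type_synonym cantor = "nat \<Rightarrow> bool"

text \<open>For a set \<open>a\<close> of natural numbers, the functions from \<open>a\<close> to the digits are the
  elements of \<open>a \<rightarrow>\<^sub>E UNIV\<close>, i.e. functions on all of \<^typ>\<open>nat\<close> that are \<^const>\<open>undefined\<close> outside
  \<open>a\<close>; restriction to \<open>a\<close> is the library's \<^const>\<open>restrict\<close>.\<close>

definition small :: "cantor set \<Rightarrow> bool" where
  "small A \<longleftrightarrow>
    (\<exists>(P :: nat set set) (J :: nat set \<Rightarrow> cantor set).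
      partition_on UNIV P \<and> (\<forall>a\<in>P. finite a) \<and>
      (\<forall>a\<in>P. J a \<subseteq> (a \<rightarrow>\<^sub>E UNIV)) \<and>
      (\<lambda>a. real (card (J a)) / 2 ^ card a) summable_on P \<and>
      A = {x. infinite {a \<in> P. restrict x a \<in> J a}})"

definition cantor_split :: "cantor \<Rightarrow> cantor \<times> cantor" where
  "cantor_split z = (\<lambda>n. z (2 * n), \<lambda>n. z (2 * n + 1))"

definition small_prod :: "(cantor \<times> cantor) set \<Rightarrow> bool" where
  "small_prod A \<longleftrightarrow> (\<exists>B. small B \<and> A = cantor_split ` B)"

definition is_tree :: "bool list set \<Rightarrow> bool" where
  "is_tree T \<longleftrightarrow> T \<noteq> {} \<and> (\<forall>\<tau>\<in>T. \<forall>\<sigma>. prefix \<sigma> \<tau> \<longrightarrow> \<sigma> \<in> T)"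

definition tree_body :: "bool list set \<Rightarrow> cantor set" where
  "tree_body T = {x. \<forall>n. map x [0..<n] \<in> T}"

definition perfect_tree :: "bool list set \<Rightarrow> bool" where
  "perfect_tree T \<longleftrightarrow> is_tree T \<and>
    (\<forall>\<sigma>\<in>T. \<exists>\<tau>\<in>T. prefix \<sigma> \<tau> \<and> \<tau> @ [False] \<in> T \<and> \<tau> @ [True] \<in> T)"

definition silver_tree :: "bool list set \<Rightarrow> bool" where
  "silver_tree T \<longleftrightarrow> perfect_tree T \<and>
    (\<forall>\<sigma>\<in>T. \<forall>\<tau>\<in>T. length \<sigma> = length \<tau> \<longrightarrow> (\<forall>a. \<sigma> @ [a] \<in> T \<longleftrightarrow> \<tau> @ [a] \<in> T))"

end

theory Submission
  imports Defs
begin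

text \<open>
  Two sequences that differ in a single digit are already as close as one needs. Cut the digit
  positions into finite blocks \<open>I\<^sub>n\<close> with \<open>2 ^ n\<close> elements and let \<open>A\<close> consist of the pairs
  \<open>(x, y)\<close> that agree on infinitely many \<open>I\<^sub>n\<close>. Two independent random sequences agree on \<open>I\<^sub>n\<close>
  with probability \<open>1 / 2 ^ (2 ^ n)\<close>, and these numbers are summable, so \<open>A\<close> is small.

  On the other hand, a Silver tree is given by choosing, independently at each level, which digits
  are allowed there, and both digits are allowed at some level. So its body contains two branches
  that differ exactly at that level. They agree on all blocks but one, hence lie in \<open>A\<close> off the
  diagonal.

  Under the interleaving of pairs, position \<open>i\<close> of both sequences corresponds to the positions
  \<open>2 * i\<close> and \<open>2 * i + 1\<close>, i.e. to those \<open>k\<close> with \<open>k div 2 = i\<close>, and equality of the two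
  sequences on \<open>I\<^sub>n\<close> means that the digit at \<open>k\<close> depends only on \<open>k div 2\<close>.
\<close>

section \<open>Branches of Silver trees\<close>

lemma is_tree_take:
  assumes "is_tree T" "\<sigma> \<in> T"
  shows "take n \<sigma> \<in> T"
  using assms take_is_prefix unfolding is_tree_def by blast

lemma perfect_tree_extend:
  assumes "perfect_tree T" "\<sigma> \<in> T"
  shows "\<exists>a. \<sigma> @ [a] \<in> T"
proof -
  from assms obtain \<tau> where \<tau>: "prefix \<sigma> \<tau>" "\<tau> @ [False] \<in> T" and T: "is_tree T"
    unfolding perfect_tree_def by blast
  from \<tau>(1) obtain \<rho> where "\<tau> = \<sigma> @ \<rho>"
    by (auto elim: prefixE)
  then have "take (Suc (length \<sigma>)) (\<tau> @ [False]) = \<sigma> @ [hd (\<rho> @ [False])]"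
    by (cases \<rho>) auto
  with is_tree_take[OF T \<tau>(2)] show ?thesis by metis
qed

lemma silver_tree_same_length:
  assumes "silver_tree T" "\<sigma> \<in> T" "\<tau> \<in> T" "length \<sigma> = length \<tau>" "\<sigma> @ [a] \<in> T"
  shows "\<tau> @ [a] \<in> T"
  using assms unfolding silver_tree_def by blast

lemma Nil_in_silver_tree:
  assumes "silver_tree T"
  shows "[] \<in> T"
proof -
  have T: "is_tree T"
    using assms unfolding silver_tree_def perfect_tree_def by blast
  then obtain \<sigma> where "\<sigma> \<in> T"
    unfolding is_tree_def by blast
  with is_tree_take[OF T, of \<sigma> 0] show ?thesis by simp
qed

text \<open>All nodes of a level allow the same digits, so a branch arises from choosing an allowed digit at
  each level separately, without keeping track of the node reached so far.\<close>

lemma tree_body_silverI: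
  assumes S: "silver_tree T"
    and allowed: "\<And>n. \<exists>\<sigma>\<in>T. length \<sigma> = n \<and> \<sigma> @ [x n] \<in> T"
  shows "x \<in> tree_body T"
proof -
  have "map x [0..<n] \<in> T" for n
  proof (induction n)
    case 0
    show ?case using Nil_in_silver_tree[OF S] by simp
  next
    case (Suc n)
    from allowed obtain \<sigma> where "\<sigma> \<in> T" "length \<sigma> = n" "\<sigma> @ [x n] \<in> T" by blast
    with Suc show ?case using silver_tree_same_length[OF S, of \<sigma> "map x [0..<n]"] by simp
  qed
  then show ?thesis unfolding tree_body_def by simp
qed

lemma silver_tree_body_nonempty:
  assumes S: "silver_tree T"
  shows "\<exists>x. x \<in> tree_body T"
proof -
  have P: "perfect_tree T" using S unfolding silver_tree_def by simp
  have "\<exists>\<sigma>\<in>T. length \<sigma> = n" for n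
  proof (induction n)
    case 0
    show ?case using Nil_in_silver_tree[OF S] by auto
  next
    case (Suc n)
    then show ?case using perfect_tree_extend[OF P] by (metis length_append_singleton)
  qed
  then have "\<forall>n. \<exists>a. \<exists>\<sigma>\<in>T. length \<sigma> = n \<and> \<sigma> @ [a] \<in> T"
    using perfect_tree_extend[OF P] by metis
  then obtain x where "\<forall>n. \<exists>\<sigma>\<in>T. length \<sigma> = n \<and> \<sigma> @ [x n] \<in> T" by metis
  then show ?thesis using tree_body_silverI[OF S] by blast
qed

text \<open>Perfectness gives a splitting node, and in a Silver tree all nodes of its level split, so the
  digit at this level can be flipped in any branch.\<close>

lemma silver_tree_branches_differ_once:
  assumes S: "silver_tree T"
  shows "\<exists>x m. x \<in> tree_body T \<and> x(m := \<not> x m) \<in> tree_body T"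
proof -
  obtain x where x: "x \<in> tree_body T"
    using silver_tree_body_nonempty[OF S] by blast
  then have nodes: "map x [0..<n] \<in> T" for n
    unfolding tree_body_def by simp
  from S Nil_in_silver_tree[OF S] obtain \<sigma>
    where \<sigma>: "\<sigma> \<in> T" "\<sigma> @ [False] \<in> T" "\<sigma> @ [True] \<in> T"
    unfolding silver_tree_def perfect_tree_def by blast
  let ?m = "length \<sigma>"
  have "x(?m := \<not> x ?m) \<in> tree_body T"
  proof (rule tree_body_silverI[OF S])
    fix n
    show "\<exists>\<tau>\<in>T. length \<tau> = n \<and> \<tau> @ [(x(?m := \<not> x ?m)) n] \<in> T"
    proof (cases "n = ?m")
      case True
      with \<sigma> show ?thesis by (cases "x ?m") auto
    next
      case False
      with nodes[of n] nodes[of "Suc n"] show ?thesis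
        by (intro bexI[of _ "map x [0..<n]"]) auto
    qed
  qed
  with x show ?thesis by blast
qed

section \<open>Dyadic blocks and interleaved pairs that agree on them\<close>

definition dyadic_block :: "nat \<Rightarrow> nat set" where
  "dyadic_block n = {2 ^ n - 1 ..< 2 ^ Suc n - 1}"

definition doubled :: "nat set \<Rightarrow> nat set" where
  "doubled I = {k. k div 2 \<in> I}"

lemma mem_dyadic_block: "i \<in> dyadic_block n \<longleftrightarrow> 2 ^ n \<le> Suc i \<and> Suc i < 2 ^ Suc n"
  unfolding dyadic_block_def by auto

lemma card_dyadic_block: "card (dyadic_block n) = 2 ^ n"
  by (simp add: dyadic_block_def)

lemma finite_dyadic_block: "finite (dyadic_block n)"
  by (simp add: dyadic_block_def)

lemma ex_dyadic_block: "\<exists>n. i \<in> dyadic_block n"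
  using ex_power_ivl1[of 2 "Suc i"] by (auto simp: mem_dyadic_block)

lemma dyadic_block_unique:
  assumes "i \<in> dyadic_block m" "i \<in> dyadic_block n"
  shows "m = n"
proof -
  have le: "p \<le> q" if "i \<in> dyadic_block p" "i \<in> dyadic_block q" for p q
  proof -
    have "(2::nat) ^ p < 2 ^ Suc q"
      using that unfolding mem_dyadic_block by linarith
    then have "p < Suc q" by (rule power_less_imp_less_exp[rotated]) simp
    then show ?thesis by simp
  qed
  show ?thesis using le[OF assms] le[OF assms(2,1)] by simp
qed

lemma doubled_eq: "doubled I = (\<lambda>i. 2 * i) ` I \<union> (\<lambda>i. Suc (2 * i)) ` I"
proof -
  have "k \<in> (\<lambda>i. 2 * i) ` I \<union> (\<lambda>i. Suc (2 * i)) ` I" if "k div 2 \<in> I" for k :: nat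
    using that by (cases "even k") (auto simp: image_iff elim!: evenE oddE)
  then show ?thesis by (auto simp: doubled_def)
qed

lemma finite_doubled: "finite I \<Longrightarrow> finite (doubled I)"
  by (simp add: doubled_eq)

lemma card_doubled:
  assumes "finite I"
  shows "card (doubled I) = 2 * card I"
proof -
  have "(\<lambda>i. 2 * i) ` I \<inter> (\<lambda>i. Suc (2 * i)) ` I = {}"
    by (auto simp: double_not_eq_Suc_double)
  then show ?thesis
    using assms by (simp add: doubled_eq card_Un_disjoint card_image inj_on_def)
qed

lemma div2_image_doubled: "(\<lambda>k. k div 2) ` doubled I = I"
proof -
  have "i \<in> (\<lambda>k. k div 2) ` doubled I" if "i \<in> I" for i
    using that by (intro image_eqI[of _ _ "2 * i"]) (auto simp: doubled_def)
  then show ?thesis by (auto simp: doubled_def)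
qed

lemma inj_doubled_dyadic_block: "inj (\<lambda>n. doubled (dyadic_block n))"
proof (rule injI)
  fix m n assume "doubled (dyadic_block m) = doubled (dyadic_block n)"
  then have "dyadic_block m = dyadic_block n" by (metis div2_image_doubled)
  then have "(2::nat) ^ m = 2 ^ n" by (metis card_dyadic_block)
  then show "m = n" by simp
qed

lemma partition_on_doubled_dyadic_blocks:
  "partition_on UNIV (range (\<lambda>n. doubled (dyadic_block n)))"
proof (rule partition_onI)
  show "\<Union> (range (\<lambda>n. doubled (dyadic_block n))) = UNIV"
    using ex_dyadic_block by (auto simp: doubled_def)
  show "disjnt p q"
    if "p \<in> range (\<lambda>n. doubled (dyadic_block n))" "q \<in> range (\<lambda>n. doubled (dyadic_block n))"
      "p \<noteq> q" for p q
  proof -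
    from that obtain m n where mn: "p = doubled (dyadic_block m)" "q = doubled (dyadic_block n)"
      "m \<noteq> n" by blast
    have False if "k \<in> p" "k \<in> q" for k
      using that mn dyadic_block_unique[of "k div 2" m n] by (simp add: doubled_def)
    then show ?thesis by (auto simp: disjnt_def)
  qed
  have "dyadic_block n \<noteq> {}" for n
    using card_dyadic_block[of n] by force
  then have "doubled (dyadic_block n) \<noteq> {}" for n
    using div2_image_doubled[of "dyadic_block n"] by force
  then show "{} \<notin> range (\<lambda>n. doubled (dyadic_block n))"
    by auto
qed

text \<open>The interleavings, restricted to \<open>a\<close>, of pairs whose two components agree.\<close>

definition agreeing :: "nat set \<Rightarrow> cantor set" where
  "agreeing a = {restrict (\<lambda>k. x (k div 2)) a | x. True}"

lemma agreeing_subset: "agreeing a \<subseteq> a \<rightarrow>\<^sub>E UNIV"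
  by (auto simp: agreeing_def)

text \<open>Only the digits of the common component matter, and there is one for every two positions.\<close>

lemma card_agreeing_doubled:
  assumes "finite I"
  shows "card (agreeing (doubled I)) \<le> 2 ^ card I"
proof -
  let ?double = "\<lambda>x. restrict (\<lambda>k. x (k div 2)) (doubled I)"
  let ?X = "I \<rightarrow>\<^sub>E (UNIV :: bool set)"
  have "?double x \<in> ?double ` ?X" for x
    by (rule image_eqI[of _ _ "restrict x I"]) (auto simp: doubled_def restrict_def)
  then have "agreeing (doubled I) \<subseteq> ?double ` ?X"
    by (auto simp: agreeing_def)
  moreover have "finite ?X" by (simp add: finite_PiE assms)
  ultimately have "card (agreeing (doubled I)) \<le> card ?X"
    by (meson card_image_le card_mono finite_imageI order_trans)
  also have "\<dots> = 2 ^ card I" by (simp add: card_PiE assms)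
  finally show ?thesis .
qed

lemma summable_agreeing:
  "(\<lambda>a. real (card (agreeing a)) / 2 ^ card a) summable_on range (\<lambda>n. doubled (dyadic_block n))"
proof -
  have bound: "real (card (agreeing (doubled (dyadic_block n)))) / 2 ^ card (doubled (dyadic_block n))
      \<le> (1 / 2) ^ n" for n
  proof -
    have "real (card (agreeing (doubled (dyadic_block n)))) \<le> 2 ^ 2 ^ n"
      using card_agreeing_doubled[OF finite_dyadic_block[of n]]
      by (simp add: card_dyadic_block)
    then have "real (card (agreeing (doubled (dyadic_block n)))) / 2 ^ (2 * 2 ^ n)
        \<le> 2 ^ 2 ^ n / 2 ^ (2 * 2 ^ n)"
      by (intro divide_right_mono) auto
    also have "\<dots> = (1 / 2) ^ 2 ^ n"
      by (simp add: mult_2 power_add power_divide)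
    also have "\<dots> \<le> (1 / 2) ^ n"
      by (intro power_decreasing) (auto intro: less_imp_le[OF less_exp])
    finally show ?thesis
      by (simp add: card_doubled finite_dyadic_block card_dyadic_block)
  qed
  have "(\<lambda>n. (1 / 2 :: real) ^ n) summable_on UNIV"
    by (rule norm_summable_imp_summable_on) (simp add: summable_geometric)
  then have "(\<lambda>n. real (card (agreeing (doubled (dyadic_block n))))
      / 2 ^ card (doubled (dyadic_block n))) summable_on UNIV"
    by (rule summable_on_comparison_test) (use bound in auto)
  then show ?thesis
    using summable_on_reindex[OF inj_doubled_dyadic_block,
        of "\<lambda>a. real (card (agreeing a)) / 2 ^ card a"]
    by (simp add: o_def)
qed

definition agreeing_often :: "cantor set" where
  "agreeing_often =
    {z. infinite {a \<in> range (\<lambda>n. doubled (dyadic_block n)). restrict z a \<in> agreeing a}}"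

lemma small_agreeing_often: "small agreeing_often"
  unfolding small_def
proof (intro exI conjI)
  show "agreeing_often =
      {z. infinite {a \<in> range (\<lambda>n. doubled (dyadic_block n)). restrict z a \<in> agreeing a}}"
    by (rule agreeing_often_def)
qed (use summable_agreeing partition_on_doubled_dyadic_blocks in
    \<open>auto simp: agreeing_subset finite_doubled finite_dyadic_block\<close>)

definition interleave :: "cantor \<Rightarrow> cantor \<Rightarrow> cantor" where
  "interleave x y k = (if even k then x else y) (k div 2)"

lemma cantor_split_interleave: "cantor_split (interleave x y) = (x, y)"
  by (simp add: cantor_split_def interleave_def)

lemma interleave_agreeing_often:
  assumes "\<And>i. i \<noteq> m \<Longrightarrow> x i = y i"
  shows "interleave x y \<in> agreeing_often"
proof -
  let ?B = "\<lambda>n. doubled (dyadic_block n)"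
  obtain N where N: "m \<in> dyadic_block N" using ex_dyadic_block by blast
  have "restrict (interleave x y) (?B n) \<in> agreeing (?B n)" if "n \<noteq> N" for n
  proof -
    have "m \<notin> dyadic_block n" using dyadic_block_unique N that by blast
    then have "interleave x y k = x (k div 2)" if "k \<in> ?B n" for k
      using that assms[of "k div 2"] by (cases "k div 2 = m") (auto simp: interleave_def doubled_def)
    then have "restrict (interleave x y) (?B n) = restrict (\<lambda>k. x (k div 2)) (?B n)"
      by (rule restrict_ext)
    then show ?thesis by (auto simp: agreeing_def)
  qed
  then have "?B ` (- {N}) \<subseteq> {a \<in> range ?B. restrict (interleave x y) a \<in> agreeing a}"
    by auto
  moreover have "infinite (?B ` (- {N}))"
  proof -
    have "inj_on ?B (- {N})" using inj_doubled_dyadic_block inj_on_subset by blast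
    then show ?thesis by (simp add: finite_image_iff Compl_eq_Diff_UNIV)
  qed
  ultimately show ?thesis
    unfolding agreeing_often_def by (auto dest: infinite_super)
qed

theorem proposition13:
  shows "\<exists>A :: (cantor \<times> cantor) set. small_prod A \<and>
    (\<forall>S. silver_tree S \<longrightarrow>
      (A \<inter> (tree_body S \<times> tree_body S)) - {(x, x) | x. True} \<noteq> {})"
proof (intro exI conjI allI impI)
  show "small_prod (cantor_split ` agreeing_often)"
    using small_agreeing_often unfolding small_prod_def by blast
  fix S assume "silver_tree S"
  then obtain x m where x: "x \<in> tree_body S" "x(m := \<not> x m) \<in> tree_body S"
    using silver_tree_branches_differ_once by blast
  define y where "y = x(m := \<not> x m)"
  have "interleave x y \<in> agreeing_often"
    by (rule interleave_agreeing_often[of m]) (simp add: y_def)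
  then have "(x, y) \<in> cantor_split ` agreeing_often"
    using cantor_split_interleave by (metis image_eqI)
  moreover have "(x, y) \<in> tree_body S \<times> tree_body S"
    using x by (simp add: y_def)
  moreover have "(x, y) \<notin> {(x, x) | x. True}"
  proof -
    have "x m \<noteq> y m" by (simp add: y_def)
    then show ?thesis by auto
  qed
  ultimately show
    "cantor_split ` agreeing_often \<inter> (tree_body S \<times> tree_body S) - {(x, x) | x. True} \<noteq> {}"
    by (metis (no_types, lifting) DiffI IntI empty_iff)
qed

end
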